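(* Let $n>1$ and let $A$ be any string of length $n$ over $\{\mathrm{H},\mathrm{T}\}$, chosen by Alice. If Bob chooses his string after Alice, he can force a win for himself, and moreover in less than $n+2$ turns: there exists a string $B\neq A$ of length $n$ such that Bob wins the No-Flippancy game with Alice's string $A$ and Bob's string $B$, and this game ends in fewer than $n+2$ turns.
   Context: No-Flippancy game: Alice and Bob have distinct strings $A=A_1\cdots A_n$ and $B=B_1\cdots B_n$ of the same length $n$ over the alphabet $\{\mathrm{H},\mathrm{T}\}$. Starting from the empty sequence, the players alternate turns, Alice going first, and on each turn the current player appends one letter to the sequence (the game output) as follows: let $i<n$ be the maximal length of a suffix of the current sequence that coincides with a prefix of the current player's string ($i=0$ is allowed, via the empty suffix); the player appends the letter with index $i+1$ of their own string. The game ends as soon as $A$ or $B$ appears as a block of consecutive letters in the sequence (necessarily as its suffix, no matter who made the last move); the player whose string appears first wins. If neither string ever appears, the game is infinite. The number of turns is the number of letters appended (by both players together). *)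

theory Defs
  imports Main "HOL-Library.Sublist"
begin

datatype coin = Heads | Tails

text \<open>The set below is finite, and it contains 0 whenever the string is nonempty.\<close>

definition overlap :: "coin list \<Rightarrow> coin list \<Rightarrow> nat" where
  "overlap P s = Max {i. i < length P \<and> suffix (take i P) s}"

text \<open>Letters are indexed from 0 here, so index \<open>i\<close> is the letter with index \<open>i + 1\<close> in
  one-based counting.\<close>

definition next_letter :: "coin list \<Rightarrow> coin list \<Rightarrow> coin" where
  "next_letter P s = P ! overlap P s"

definition game_over :: "coin list \<Rightarrow> coin list \<Rightarrow> coin list \<Rightarrow> bool" where
  "game_over A B s \<longleftrightarrow> sublist A s \<or> sublist B s"

text \<open>\<open>reached A B s\<close>: the sequence \<open>s\<close> occurs (after \<open>length s\<close> turns) in the game with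
  Alice's string \<open>A\<close> and Bob's string \<open>B\<close>. Alice moves first, hence at even lengths.\<close>

inductive reached :: "coin list \<Rightarrow> coin list \<Rightarrow> coin list \<Rightarrow> bool" for A B where
  start: "reached A B []"
| turn: "reached A B s \<Longrightarrow> \<not> game_over A B s \<Longrightarrow>
    reached A B (s @ [next_letter (if even (length s) then A else B) s])"

definition final_output :: "coin list \<Rightarrow> coin list \<Rightarrow> coin list \<Rightarrow> bool" where
  "final_output A B s \<longleftrightarrow> reached A B s \<and> game_over A B s"

text \<open>No earlier sequence of the game contains either string, so the string contained in
  the final output is the one that appears first.\<close>

definition bob_wins_with_output :: "coin list \<Rightarrow> coin list \<Rightarrow> coin list \<Rightarrow> bool" where
  "bob_wins_with_output A B s \<longleftrightarrow> final_output A B s \<and> sublist B s \<and> \<not> sublist A s"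

lemma reached_unique:
  assumes "reached A B s" "reached A B t" "length s = length t"
  shows "s = t"
  using assms
proof (induction arbitrary: t rule: reached.induct)
  case start
  then show ?case by simp
next
  case (turn s)
  from turn.prems(1) show ?case
  proof cases
    case start
    with turn.prems show ?thesis by simp
  next
    case (turn t')
    with turn.IH[of t'] turn.prems show ?thesis by simp
  qed
qed

lemma reached_strict_prefix:
  assumes "reached A B t" "strict_prefix s t"
  shows "reached A B s \<and> \<not> game_over A B s"
  using assms by (induction rule: reached.induct) (auto simp: strict_prefix_def)

lemma reached_take: "reached A B t \<Longrightarrow> reached A B (take k t)"
  using reached_strict_prefix[of A B t "take k t"] take_is_prefix[of k t]
  by (cases "take k t = t") (simp_all add: strict_prefix_def)

lemma final_output_maximal:
  assumes "final_output A B s" "reached A B t"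
  shows "prefix t s"
proof (cases "length t \<le> length s")
  case True
  have "t = take (length t) s"
    by (rule reached_unique[OF assms(2) reached_take])
      (use assms True in \<open>auto simp: final_output_def\<close>)
  then show ?thesis by (metis take_is_prefix)
next
  case False
  have "s = take (length s) t"
    by (rule reached_unique[OF _ reached_take[OF assms(2)]])
      (use assms False in \<open>auto simp: final_output_def\<close>)
  with False have "strict_prefix s t"
    by (metis take_is_prefix strict_prefix_def order_refl)
  with reached_strict_prefix[OF assms(2)] assms(1) show ?thesis
    by (auto simp: final_output_def)
qed

lemma final_output_unique: "final_output A B s \<Longrightarrow> final_output A B t \<Longrightarrow> s = t"
  by (meson final_output_def final_output_maximal prefix_order.antisym)

end

theory Submission
  imports Defs
begin

text \<open>Bob moves second, and as long as the sequence is a prefix of \<open>B\<close> his rule makes him play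
  the next letter of \<open>B\<close>. So let Bob's letters be arbitrary, let Alice answer by her rule, and
  take as \<open>B\<close> the resulting sequence of length \<open>n\<close>: the game then outputs \<open>B\<close> after \<open>n\<close> turns.
  Bob always playing the opposite of the corresponding letter of \<open>A\<close> ensures \<open>B \<noteq> A\<close>.\<close>

primrec opposing_play :: "coin list \<Rightarrow> nat \<Rightarrow> coin list" where
  "opposing_play A 0 = []"
| "opposing_play A (Suc k) = opposing_play A k @
     [if even k then next_letter A (opposing_play A k)
      else if A ! k = Heads then Tails else Heads]"

lemma length_opposing_play [simp]: "length (opposing_play A k) = k"
  by (induction k) auto

lemma take_opposing_play: "k \<le> m \<Longrightarrow> take k (opposing_play A m) = opposing_play A k"
  by (induction m) (auto simp: le_Suc_eq)

lemma nth_opposing_play: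
  assumes "k < m"
  shows "opposing_play A m ! k = opposing_play A (Suc k) ! k"
  using assms take_opposing_play[of "Suc k" m A] by (metis Suc_leI lessI nth_take)

text \<open>The whole prefix is its own longest suffix, so a player whose string begins with the
  sequence so far just continues that string.\<close>

lemma overlap_take_self:
  assumes "k < length P"
  shows "overlap P (take k P) = k"
  unfolding overlap_def
proof (rule Max_eqI)
  fix i assume "i \<in> {i. i < length P \<and> suffix (take i P) (take k P)}"
  then show "i \<le> k" using assms by (auto dest: suffix_length_le)
qed (use assms in auto)

lemma not_game_over_short:
  "length s < length A \<Longrightarrow> length s < length B \<Longrightarrow> \<not> game_over A B s"
  by (auto simp: game_over_def dest: sublist_length_le)

text \<open>Alice's letters agree by construction, as her rule depends only on \<open>A\<close> and
  the sequence so far; Bob's agree because he continues his own string. Sequences shorter than both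
  strings cannot end the game.\<close>

lemma reached_opposing_play:
  assumes "k \<le> length A"
  shows "reached A (opposing_play A (length A)) (opposing_play A k)"
  using assms
proof (induction k)
  case 0
  show ?case by (simp add: reached.start)
next
  case (Suc k)
  let ?B = "opposing_play A (length A)" and ?s = "opposing_play A k"
  have "next_letter ?B ?s = ?B ! k"
    using overlap_take_self[of k ?B] Suc.prems by (simp add: next_letter_def take_opposing_play)
  also have "\<dots> = opposing_play A (Suc k) ! k"
    using Suc.prems by (simp add: nth_opposing_play)
  finally have "opposing_play A (Suc k) =
      ?s @ [next_letter (if even (length ?s) then A else ?B) ?s]"
    by (simp add: nth_append)
  moreover have "\<not> game_over A ?B ?s"
    using Suc.prems by (simp add: not_game_over_short)
  ultimately show ?case
    using Suc reached.turn[of A ?B ?s] by simp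
qed

lemma opposing_play_neq:
  assumes "length A > 1"
  shows "opposing_play A (length A) \<noteq> A"
proof
  assume "opposing_play A (length A) = A"
  \<comment> \<open>Index 1 is Bob's first turn, where he plays the opposite of
    \<open>A ! 1\<close>.\<close>
  then have "opposing_play A (Suc 1) ! 1 = A ! 1"
    using nth_opposing_play[of 1 "length A" A] assms by simp
  then show False by (simp add: nth_append split: if_splits)
qed

theorem lemma4:
  fixes A :: "coin list" and n :: nat
  assumes "n > 1" and "length A = n"
  shows "\<exists>B. length B = n \<and> B \<noteq> A \<and>
           (\<exists>s. bob_wins_with_output A B s \<and> length s < n + 2)"
proof (intro exI conjI)
  let ?B = "opposing_play A n"
  show "?B \<noteq> A" using assms opposing_play_neq by blast
  \<comment> \<open>Equal lengths leave no room around \<open>A\<close>, so Alice's string cannot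
    appear together with Bob's.\<close>
  have "A = ?B" if "sublist A ?B"
  proof -
    from that obtain ps ss where B: "?B = ps @ A @ ss" by (auto simp: sublist_def)
    then have "length (ps @ A @ ss) = length A" using assms by (metis length_opposing_play)
    with B show ?thesis by simp
  qed
  with \<open>?B \<noteq> A\<close> have "\<not> sublist A ?B" by auto
  then show "bob_wins_with_output A ?B ?B"
    using reached_opposing_play[of n A] assms
    by (simp add: bob_wins_with_output_def final_output_def game_over_def)
qed simp_all

end
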